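(* There is no finite presentation for the submonoid of the braid group of type $G(e,e,r)$ generated by the Broué-Malle-Rouquier generators.
   Context: Here $e$ is a positive integer and $r=n+1$ with $n$ a positive integer. For letters $a,b$, $\langle ab\rangle^k$ denotes the alternating product $aba\cdots$ of length $k$. The braid group $B(e,e,r)$ of the complex reflection group $G(e,e,r)$ (the fundamental group of the space of regular orbits) is, by a theorem of Broué-Malle-Rouquier, isomorphic to the group with generators $\tau_2,\tau_2',\tau_3,\dots,\tau_r$ (the Broué-Malle-Rouquier generators) and relations: $\tau_i\tau_j=\tau_j\tau_i$ for $|i-j|\geq2$; $\tau_2'\tau_j=\tau_j\tau_2'$ for $j\geq4$; $\langle\tau_2\tau_2'\rangle^e=\langle\tau_2'\tau_2\rangle^e$; $\tau_i\tau_{i+1}\tau_i=\tau_{i+1}\tau_i\tau_{i+1}$ for $i=2,\dots,r-1$; $\tau_2'\tau_3\tau_2'=\tau_3\tau_2'\tau_3$; $\tau_3\tau_2\tau_2'\tau_3\tau_2\tau_2'=\tau_2\tau_2'\tau_3\tau_2\tau_2'\tau_3$.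
   Formalization: Proved for e ≥ 3 and r ≥ 3 only; for e = 1, e = 2 or r = 2 the claim is false, since the submonoid is then a finitely presented Artin monoid (type A, type D or dihedral). *)

theory Defs
  imports "HOL-Algebra.Group"
begin

section \<open>Monoid and group presentations\<close>

inductive word_cong :: "('a list \<times> 'a list) set \<Rightarrow> 'a list \<Rightarrow> 'a list \<Rightarrow> bool"
  for R where
  rel: "(u, v) \<in> R \<Longrightarrow> word_cong R u v"
| refl: "word_cong R u u"
| sym: "word_cong R u v \<Longrightarrow> word_cong R v u"
| trans: "word_cong R u v \<Longrightarrow> word_cong R v w \<Longrightarrow> word_cong R u w"
| append: "word_cong R u v \<Longrightarrow> word_cong R u' v' \<Longrightarrow> word_cong R (u @ u') (v @ v')"

definition word_rel :: "'a set \<Rightarrow> ('a list \<times> 'a list) set \<Rightarrow> ('a list \<times> 'a list) set" where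
  "word_rel A R = {(u, v). u \<in> lists A \<and> v \<in> lists A \<and> word_cong R u v}"

text \<open>The monoid \<open>\<langle>A | R\<rangle>\<close>: the quotient of the free monoid \<open>lists A\<close> by the congruence
  generated by \<open>R\<close>, which is meant to satisfy \<open>R \<subseteq> lists A \<times> lists A\<close>.\<close>

definition presented_monoid :: "'a set \<Rightarrow> ('a list \<times> 'a list) set \<Rightarrow> 'a list set monoid" where
  "presented_monoid A R =
    \<lparr>carrier = lists A // word_rel A R,
     mult = (\<lambda>X Y. \<Union>u\<in>X. \<Union>v\<in>Y. word_rel A R `` {u @ v}),
     one = word_rel A R `` {[]}\<rparr>"

text \<open>Group words are words in signed letters: \<open>(a, True)\<close> stands for \<open>a\<close> and \<open>(a, False)\<close> for
  its formal inverse.  The group \<open>\<langle>A | R\<rangle>\<close> is the monoid on the signed letters with the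
  cancellation relations added.\<close>

definition cancellations :: "'a set \<Rightarrow> (('a \<times> bool) list \<times> ('a \<times> bool) list) set" where
  "cancellations A = {([(a, b), (a, \<not> b)], []) | a b. a \<in> A}"

definition presented_group ::
    "'a set \<Rightarrow> (('a \<times> bool) list \<times> ('a \<times> bool) list) set \<Rightarrow> ('a \<times> bool) list set monoid" where
  "presented_group A R = presented_monoid (A \<times> UNIV) (R \<union> cancellations A)"

text \<open>The element of \<open>\<langle>A | R\<rangle>\<close> represented by a group word.\<close>

definition group_class ::
    "'a set \<Rightarrow> (('a \<times> bool) list \<times> ('a \<times> bool) list) set \<Rightarrow> ('a \<times> bool) list \<Rightarrow>
      ('a \<times> bool) list set" where
  "group_class A R w = word_rel (A \<times> UNIV) (R \<union> cancellations A) `` {w}"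

abbreviation pos_word :: "'a list \<Rightarrow> ('a \<times> bool) list" where
  "pos_word \<equiv> map (\<lambda>a. (a, True))"

text \<open>Every finite alphabet can be renamed to a finite set of natural numbers, so quantifying over
  alphabets of type \<^typ>\<open>nat set\<close> is no restriction.  A bijection in \<^const>\<open>iso\<close> between monoids
  preserves the unit automatically.\<close>

definition finitely_presented_monoid :: "('m, 'k) monoid_scheme \<Rightarrow> bool" where
  "finitely_presented_monoid M \<longleftrightarrow>
    (\<exists>(A :: nat set) R. finite A \<and> finite R \<and> R \<subseteq> lists A \<times> lists A \<and> presented_monoid A R \<cong> M)"

definition generated_submonoid :: "('m, 'k) monoid_scheme \<Rightarrow> 'm set \<Rightarrow> ('m, 'k) monoid_scheme" where
  "generated_submonoid G S = G\<lparr>carrier := \<Inter>{H. submonoid H G \<and> S \<subseteq> H}\<rparr>"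


lemma equiv_word_rel: "equiv (lists A) (word_rel A R)"
  by (rule equivI)
     (auto simp: word_rel_def refl_on_def sym_def trans_def
       intro: word_cong.refl word_cong.sym word_cong.trans)

lemma carrier_presented_monoid: "carrier (presented_monoid A R) = lists A // word_rel A R"
  by (simp add: presented_monoid_def)

lemma mult_presented_monoid:
  assumes "u \<in> lists A" "v \<in> lists A"
  shows "mult (presented_monoid A R) (word_rel A R `` {u}) (word_rel A R `` {v}) =
    word_rel A R `` {u @ v}"
proof -
  have "word_rel A R `` {u' @ v'} = word_rel A R `` {u @ v}"
    if "u' \<in> word_rel A R `` {u}" "v' \<in> word_rel A R `` {v}" for u' v'
  proof (rule equiv_class_eq[OF equiv_word_rel])
    show "(u' @ v', u @ v) \<in> word_rel A R"
      using that by (auto simp: word_rel_def intro: word_cong.append word_cong.sym)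
  qed
  moreover have "u \<in> word_rel A R `` {u}" "v \<in> word_rel A R `` {v}"
    using assms by (auto simp: word_rel_def intro: word_cong.refl)
  ultimately show ?thesis
    unfolding presented_monoid_def monoid.simps by (intro equalityI UN_least) (blast+)
qed

lemma presented_monoid_monoid: "monoid (presented_monoid A R)"
proof (rule monoidI, goal_cases)
  case (1 x y)
  then show ?case
    unfolding carrier_presented_monoid
    by (elim quotientE) (simp add: mult_presented_monoid quotientI)
next
  case 2
  then show ?case by (simp add: presented_monoid_def quotientI)
next
  case (3 x y z)
  then show ?case
    unfolding carrier_presented_monoid
    by (elim quotientE) (simp add: mult_presented_monoid)
next
  case (4 x)
  moreover have "one (presented_monoid A R) = word_rel A R `` {[]}"
    by (simp add: presented_monoid_def)
  ultimately show ?case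
    unfolding carrier_presented_monoid
    by (elim quotientE) (simp add: mult_presented_monoid)
next
  case (5 x)
  moreover have "one (presented_monoid A R) = word_rel A R `` {[]}"
    by (simp add: presented_monoid_def)
  ultimately show ?case
    unfolding carrier_presented_monoid
    by (elim quotientE) (simp add: mult_presented_monoid)
qed

lemma word_cong_inverse_word:
  assumes "w \<in> lists (A \<times> UNIV)"
  shows "word_cong (R \<union> cancellations A) (rev (map (\<lambda>(a, b). (a, \<not> b)) w) @ w) []"
  using assms
proof (induction w)
  case Nil
  show ?case by (simp add: word_cong.refl)
next
  case (Cons x w)
  obtain a b where x: "x = (a, b)" by (cases x)
  let ?i = "rev (map (\<lambda>(a, b). (a, \<not> b)) w)"
  let ?C = "word_cong (R \<union> cancellations A)"
  have "([(a, \<not> b), (a, \<not> \<not> b)], []) \<in> cancellations A"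
    using Cons.hyps(1) x unfolding cancellations_def by blast
  then have "?C [(a, \<not> b), (a, b)] []"
    by (intro word_cong.rel) simp
  then have "?C (?i @ [(a, \<not> b), (a, b)] @ w) (?i @ [] @ w)"
    by (intro word_cong.append word_cong.refl)
  then have "?C (?i @ [(a, \<not> b), (a, b)] @ w) []"
    using word_cong.trans[OF _ Cons.IH] by simp
  then show ?case using x by simp
qed

lemma presented_group_group: "group (presented_group A R)"
proof -
  let ?S = "R \<union> cancellations A"
  let ?G = "presented_monoid (A \<times> UNIV) ?S"
  interpret monoid ?G by (rule presented_monoid_monoid)
  have "\<exists>y\<in>carrier ?G. mult ?G y x = one ?G" if x: "x \<in> carrier ?G" for x
  proof -
    obtain w where w: "w \<in> lists (A \<times> UNIV)" "x = word_rel (A \<times> UNIV) ?S `` {w}"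
      using x unfolding carrier_presented_monoid by (rule quotientE)
    let ?i = "rev (map (\<lambda>(a, b). (a, \<not> b)) w)"
    have i: "?i \<in> lists (A \<times> UNIV)" using w(1) by auto
    have "mult ?G (word_rel (A \<times> UNIV) ?S `` {?i}) x = word_rel (A \<times> UNIV) ?S `` {?i @ w}"
      using i w by (simp only: mult_presented_monoid)
    also have "\<dots> = one ?G"
      using word_cong_inverse_word[OF w(1)] i w(1)
      unfolding presented_monoid_def monoid.simps
      by (intro equiv_class_eq[OF equiv_word_rel]) (simp add: word_rel_def)
    finally show ?thesis
      using quotientI[OF i, of "word_rel (A \<times> UNIV) ?S"]
      unfolding carrier_presented_monoid by blast
  qed
  then show ?thesis
    unfolding presented_group_def
    by (intro groupI m_closed one_closed l_one m_assoc)
qed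

lemma submonoid_generated_submonoid:
  assumes "monoid G" "S \<subseteq> carrier G"
  shows "submonoid (carrier (generated_submonoid G S)) G" "S \<subseteq> carrier (generated_submonoid G S)"
proof -
  interpret monoid G by fact
  have "submonoid (carrier G) G" by (simp add: submonoid_def)
  then show "submonoid (carrier (generated_submonoid G S)) G"
    using assms(2) by (auto simp: generated_submonoid_def submonoid_def)
  show "S \<subseteq> carrier (generated_submonoid G S)"
    by (auto simp: generated_submonoid_def)
qed


section \<open>The braid group of type \<open>G(e,e,r)\<close>\<close>

text \<open>\<open>Tau i\<close> is \<open>\<tau>\<^sub>i\<close> (used for \<open>2 \<le> i \<le> r\<close>), and \<open>Tau2'\<close> is the additional generator \<open>\<tau>\<^sub>2'\<close>.\<close>

datatype bmr_letter = Tau nat | Tau2'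

definition bmr_letters :: "nat \<Rightarrow> bmr_letter set" where
  "bmr_letters r = insert Tau2' (Tau ` {2..r})"

text \<open>The alternating word \<open>aba\<dots>\<close> of length \<open>k\<close>.\<close>

fun alt_word :: "'a \<Rightarrow> 'a \<Rightarrow> nat \<Rightarrow> 'a list" where
  "alt_word a b 0 = []"
| "alt_word a b (Suc k) = a # alt_word b a k"

inductive_set bmr_relations :: "nat \<Rightarrow> nat \<Rightarrow> (bmr_letter list \<times> bmr_letter list) set"
  for e r where
  "\<lbrakk>i \<in> {2..r}; j \<in> {2..r}; \<bar>int i - int j\<bar> \<ge> 2\<rbrakk> \<Longrightarrow>
    ([Tau i, Tau j], [Tau j, Tau i]) \<in> bmr_relations e r"
| "j \<in> {4..r} \<Longrightarrow> ([Tau2', Tau j], [Tau j, Tau2']) \<in> bmr_relations e r"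
| "(alt_word (Tau 2) Tau2' e, alt_word Tau2' (Tau 2) e) \<in> bmr_relations e r"
| "i \<in> {2..<r} \<Longrightarrow>
    ([Tau i, Tau (i + 1), Tau i], [Tau (i + 1), Tau i, Tau (i + 1)]) \<in> bmr_relations e r"
| "r \<ge> 3 \<Longrightarrow> ([Tau2', Tau 3, Tau2'], [Tau 3, Tau2', Tau 3]) \<in> bmr_relations e r"
| "r \<ge> 3 \<Longrightarrow>
    ([Tau 3, Tau 2, Tau2', Tau 3, Tau 2, Tau2'],
     [Tau 2, Tau2', Tau 3, Tau 2, Tau2', Tau 3]) \<in> bmr_relations e r"

text \<open>The defining relations involve positive words only.\<close>

definition bmr_group_relations ::
    "nat \<Rightarrow> nat \<Rightarrow> ((bmr_letter \<times> bool) list \<times> (bmr_letter \<times> bool) list) set" where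
  "bmr_group_relations e r = map_prod pos_word pos_word ` bmr_relations e r"

text \<open>\<open>B(e,e,r)\<close>, given by the presentation of Broue, Malle and Rouquier.\<close>

definition bmr_braid_group :: "nat \<Rightarrow> nat \<Rightarrow> (bmr_letter \<times> bool) list set monoid" where
  "bmr_braid_group e r = presented_group (bmr_letters r) (bmr_group_relations e r)"

definition bmr_generators :: "nat \<Rightarrow> nat \<Rightarrow> (bmr_letter \<times> bool) list set set" where
  "bmr_generators e r =
    (\<lambda>a. group_class (bmr_letters r) (bmr_group_relations e r) (pos_word [a])) ` bmr_letters r"

definition bmr_submonoid :: "nat \<Rightarrow> nat \<Rightarrow> (bmr_letter \<times> bool) list set monoid" where
  "bmr_submonoid e r = generated_submonoid (bmr_braid_group e r) (bmr_generators e r)"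

lemma bmr_braid_group_group: "group (bmr_braid_group e r)"
  unfolding bmr_braid_group_def by (rule presented_group_group)

lemma bmr_generators_carrier: "bmr_generators e r \<subseteq> carrier (bmr_braid_group e r)"
  unfolding bmr_generators_def bmr_braid_group_def presented_group_def carrier_presented_monoid
    group_class_def
  by (auto intro!: quotientI)

end

theory Submission
  imports Defs
begin

text \<open>Write \<open>x = \<tau>\<^sub>2\<close>, \<open>y = \<tau>\<^sub>2'\<close>, \<open>s = \<tau>\<^sub>3\<close>. In the braid group \<open>x y\<^sup>k (s x y s) = (s x y s) x\<^sup>k y\<close> for
  every \<open>k\<close>. For \<open>k \<ge> 2\<close> these are the only two positive words representing this element; as
  they differ in their first and in their last letters, no relations between shorter words
  connect them, so every presentation contains relations of unbounded length.

  To see that there is no third word, follow the two strands that start at the positions 1 and 2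
  and forget all others. This sends the braid group to a wreath product over
  \<open>(\<int>/e * \<int>/2) \<times> \<int>\<close>: if \<open>\<delta>\<close> and \<open>\<eta>\<close> generate the two free factors, the crossings of the two
  strands become \<open>T\<^sub>i = \<delta>\<^bsup>i+1\<^esup> \<eta> \<delta>\<^bsup>-i\<^esup>\<close>, which satisfy the dual relations \<open>T\<^bsub>i+1\<^esub> T\<^sub>i = \<delta>\<^sup>2\<close>, and the last
  factor counts them. A third strand can contribute only through a detour that turns the relative
  phase of the two strands, which costs four letters and uses up all letters that are not
  crossings of the two. What remains is to factor \<open>T\<^sub>1 T\<^sub>0\<^sup>k\<close> into \<open>k + 1\<close> elements \<open>T\<^sub>i\<close>, and normal
  forms in the free product leave two possibilities.\<close>

section \<open>An action of the free product of cyclic groups of orders \<open>e\<close> and \<open>2\<close>\<close>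

text \<open>Rotation of \<open>{0..<e}\<close>, extended by the identity so that the group laws hold on all of
  \<^typ>\<open>nat\<close>.\<close>

definition rot :: "nat \<Rightarrow> int \<Rightarrow> nat \<Rightarrow> nat" where
  "rot e a h = (if h < e then nat ((int h + a) mod int e) else h)"

lemma rot_0 [simp]: "rot e 0 h = h"
  by (simp add: rot_def)

lemma rot_less: "h < e \<Longrightarrow> rot e a h < e"
  using pos_mod_bound[of "int e" "int h + a"] by (simp add: rot_def nat_less_iff)

lemma rot_rot [simp]: "rot e a (rot e b h) = rot e (a + b) h"
proof (cases "h < e")
  case True
  then have "nat ((int h + b) mod int e) < e" using rot_less[OF True, of b] by (simp add: rot_def)
  then show ?thesis using True by (simp add: rot_def mod_simps algebra_simps)
qed (simp add: rot_def)

lemma rot_mod: "rot e (a mod int e) h = rot e a h"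
  by (simp add: rot_def mod_simps)

lemma rot_cong: "a mod int e = b mod int e \<Longrightarrow> rot e a h = rot e b h"
  using rot_mod[of e a h] rot_mod[of e b h] by simp

text \<open>\<open>(b, h, [x\<^sub>1, \<dots>, x\<^sub>m])\<close> is the reduced word \<open>\<eta>\<^sup>b \<delta>\<^bsup>x\<^sub>m + 1\<^esup> \<eta> \<dots> \<eta> \<delta>\<^bsup>x\<^sub>1 + 1\<^esup> \<eta> \<delta>\<^sup>h\<close>. Storing \<open>x - 1\<close> for an inner
  exponent \<open>x\<close> makes it nonzero by construction. The operations below are right
  multiplications by \<open>\<delta>\<^sup>a\<close>, \<open>\<eta>\<close>, \<open>T\<^sub>i\<close> and its inverse.\<close>

type_synonym normal_form = "bool \<times> nat \<times> nat list"

fun turn :: "nat \<Rightarrow> int \<Rightarrow> normal_form \<Rightarrow> normal_form" where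
  "turn e a (b, h, xs) = (b, rot e a h, xs)"

fun flip :: "normal_form \<Rightarrow> normal_form" where
  "flip (b, 0, []) = (\<not> b, 0, [])"
| "flip (b, 0, x # xs) = (b, Suc x, xs)"
| "flip (b, Suc h, xs) = (b, 0, h # xs)"

definition twist :: "nat \<Rightarrow> int \<Rightarrow> normal_form \<Rightarrow> normal_form" where
  "twist e i g = turn e (- i) (flip (turn e (i + 1) g))"

definition untwist :: "nat \<Rightarrow> int \<Rightarrow> normal_form \<Rightarrow> normal_form" where
  "untwist e i g = turn e (- i - 1) (flip (turn e i g))"

lemma turn_0 [simp]: "turn e 0 g = g"
  by (cases g) simp

lemma turn_turn [simp]: "turn e a (turn e b g) = turn e (a + b) g"
  by (cases g) simp

lemma turn_cong: "a mod int e = b mod int e \<Longrightarrow> turn e a g = turn e b g"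
  using rot_cong[of a e b] by (cases g) simp

lemma flip_flip [simp]: "flip (flip g) = g"
  by (cases g rule: flip.cases) auto

lemma untwist_twist [simp]: "untwist e i (twist e i g) = g"
  and twist_untwist [simp]: "twist e i (untwist e i g) = g"
  by (simp_all add: twist_def untwist_def)

lemma twist_cong:
  assumes "i mod int e = j mod int e"
  shows "twist e i g = twist e j g"
proof -
  have *: "(i + 1) mod int e = (j + 1) mod int e" "(- i) mod int e = (- j) mod int e"
    using mod_add_cong[OF assms HOL.refl] mod_minus_cong[OF assms] by simp_all
  show ?thesis
    unfolding twist_def turn_cong[OF *(1)] turn_cong[OF *(2)] ..
qed

lemma twist_inject: "twist e i g = twist e i h \<Longrightarrow> g = h"
  by (metis untwist_twist)

lemma twist_pred_twist: "twist e i (twist e (i + 1) g) = turn e 2 g"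
  by (simp add: twist_def)

lemma twist_turn: "twist e i (turn e a g) = turn e a (twist e (i + a) g)"
  by (simp add: twist_def algebra_simps)

fun height :: "normal_form \<Rightarrow> nat" where
  "height (b, h, xs) = of_bool b + length xs"

fun top_exp :: "normal_form \<Rightarrow> nat" where
  "top_exp (b, h, xs) = h"

lemma height_turn [simp]: "height (turn e a g) = height g"
  by (cases g) simp

lemma top_exp_turn [simp]: "top_exp (turn e a g) = rot e a (top_exp g)"
  by (cases g) simp

lemma height_flip_le: "height (flip g) \<le> Suc (height g)"
  by (cases g rule: flip.cases) auto

lemma top_exp_flip: "height (flip g) = Suc (height g) \<Longrightarrow> top_exp (flip g) = 0"
  by (cases g rule: flip.cases) auto

lemma height_flip: "top_exp g \<noteq> 0 \<or> height g = 0 \<Longrightarrow> height (flip g) = Suc (height g)"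
  by (cases g rule: flip.cases) auto

declare fold_replicate [simp del]

abbreviation twists :: "nat \<Rightarrow> int list \<Rightarrow> normal_form" where
  "twists e is \<equiv> fold (twist e) is (False, 0, [])"

lemma height_twists_le: "height (twists e is) \<le> length is"
proof (induction "is" rule: rev_induct)
  case (snoc i "is")
  have "height (twists e (is @ [i])) \<le> Suc (height (twists e is))"
    using height_flip_le[of "turn e (i + 1) (twists e is)"] by (simp add: twist_def)
  with snoc show ?case by simp
qed simp

lemma top_exp_twists:
  assumes "height (twists e (is @ [i])) = Suc (length is)"
  shows "height (twists e is) = length is" "top_exp (twists e (is @ [i])) = rot e (- i) 0"
proof -
  let ?g = "turn e (i + 1) (twists e is)"
  have 1: "height (flip ?g) = Suc (length is)"
    using assms by (simp add: twist_def)
  have 2: "height ?g \<le> length is"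
    using height_twists_le by simp
  then show "height (twists e is) = length is"
    using 1 height_flip_le[of ?g] by simp
  then have "height (flip ?g) = Suc (height ?g)" using 1 by simp
  then have "top_exp (flip ?g) = 0" by (rule top_exp_flip)
  then show "top_exp (twists e (is @ [i])) = rot e (- i) 0"
    by (simp add: twist_def)
qed

lemma rot_uminus_inject:
  assumes "rot e (- i) 0 = rot e (- j) 0" "i \<in> {0..<int e}" "j \<in> {0..<int e}"
  shows "i = j"
proof -
  have "e > 0" using assms by auto
  then have "(- i) mod int e = (- j) mod int e"
    using assms(1) by (simp add: rot_def eq_nat_nat_iff)
  then have "i mod int e = j mod int e"
    by (metis add.inverse_inverse mod_minus_eq)
  then show ?thesis using assms by simp
qed

text \<open>When no cancellation occurs, the final exponent of \<open>\<delta>\<close> reveals the last factor.\<close>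

lemma twists_inject:
  assumes "length is = length js" "twists e is = twists e js" "height (twists e is) = length is"
    and "set is \<subseteq> {0..<int e}" "set js \<subseteq> {0..<int e}"
  shows "is = js"
  using assms
proof (induction "is" arbitrary: js rule: rev_induct)
  case (snoc i "is")
  obtain js' j where js: "js = js' @ [j]"
    using snoc.prems(1) by (cases js rule: rev_cases) auto
  have hi: "height (twists e (is @ [i])) = Suc (length is)" using snoc.prems(3) by simp
  have hj: "height (twists e (js' @ [j])) = Suc (length js')"
    using snoc.prems(1,2) hi js by simp
  have "rot e (- i) 0 = rot e (- j) 0"
    using top_exp_twists(2)[OF hi] top_exp_twists(2)[OF hj] snoc.prems(2) js by simp
  then have "i = j"
    by (rule rot_uminus_inject) (use snoc.prems js in auto)
  moreover have "is = js'"
  proof (rule snoc.IH)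
    show "twists e is = twists e js'"
      using snoc.prems(2) js \<open>i = j\<close> by (auto intro: twist_inject)
    show "height (twists e is) = length is" using top_exp_twists(1)[OF hi] .
  qed (use snoc.prems js in auto)
  ultimately show ?case using js by simp
qed simp

lemma height_twists_replicate_2:
  assumes "e \<ge> 3"
  shows "height (twists e (replicate k 2)) = k \<and>
    (k > 0 \<longrightarrow> top_exp (twists e (replicate k 2)) = e - 2)"
proof (induction k)
  case (Suc k)
  let ?g = "twists e (replicate k 2)"
  have *: "rot e (- 2) 0 = e - 2"
    using assms by (simp add: rot_def zmod_zminus1_eq_if nat_diff_distrib)
  have "top_exp (turn e 3 ?g) \<noteq> 0 \<or> height (turn e 3 ?g) = 0"
  proof (cases "k = 0")
    case False
    then have "top_exp ?g = rot e (- 2) 0" using Suc * by simp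
    then have "top_exp (turn e 3 ?g) = rot e 1 0" by simp
    also have "\<dots> = 1" using assms by (simp add: rot_def)
    finally show ?thesis by simp
  qed simp
  then have "height (flip (turn e 3 ?g)) = Suc (height (turn e 3 ?g))"
    by (rule height_flip)
  then have "height (twists e (replicate k 2 @ [2])) = Suc k"
    using Suc by (simp add: twist_def)
  moreover from this have "top_exp (twists e (replicate k 2 @ [2])) = e - 2"
    using top_exp_twists(2)[of e "replicate k 2" 2] * by simp
  moreover have "replicate (Suc k) (2::int) = replicate k 2 @ [2]"
    by (simp add: replicate_append_same)
  ultimately show ?case by (metis zero_less_Suc)
qed simp

lemma twists_1_0:
  "twists e (1 # replicate (Suc k) 0) = twists e (replicate k 2 @ [i + 1, i])"
proof -
  have *: "fold (twist e) (replicate k 0) (turn e 2 g) = turn e 2 (fold (twist e) (replicate k 2) g)"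
    for g by (induction k arbitrary: g) (simp_all add: twist_turn)
  have "twists e (1 # replicate (Suc k) 0) =
      fold (twist e) (replicate k 0) (twist e 0 (twist e (0 + 1) (False, 0, [])))"
    by simp
  also have "\<dots> = turn e 2 (twists e (replicate k 2))"
    by (simp only: twist_pred_twist *)
  also have "\<dots> = twists e (replicate k 2 @ [i + 1, i])"
    by (simp add: twist_pred_twist)
  finally show ?thesis .
qed

lemma twists_eq_1_0_last:
  assumes e: "e \<ge> 3" and eq: "twists e (is @ [i]) = twists e (1 # replicate (Suc k) 0)"
    and len: "length is = Suc k" and range: "set is \<subseteq> {0..<int e}" "i \<in> {0..<int e}" and "i \<noteq> 0"
  shows "is = replicate k 2 @ [(i + 1) mod int e]"
proof (rule twists_inject[symmetric])
  let ?js = "replicate k 2 @ [(i + 1) mod int e]"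
  have 1: "twist e ((i + 1) mod int e) g = twist e (i + 1) g" for g
    by (rule twist_cong) simp
  have "twists e (is @ [i]) = twists e (?js @ [i])"
    unfolding eq twists_1_0[of e k i] by (simp add: 1)
  then show "twists e ?js = twists e is"
    by (auto dest: twist_inject)
  let ?g = "twists e (replicate k 2)"
  have "top_exp (turn e (i + 2) ?g) \<noteq> 0 \<or> height (turn e (i + 2) ?g) = 0"
  proof (cases "k = 0")
    case False
    then have "top_exp ?g = e - 2" using height_twists_replicate_2[OF e, of k] by simp
    then have "top_exp (turn e (i + 2) ?g) = nat ((int e + i) mod int e)"
      using e by (simp add: rot_def algebra_simps of_nat_diff)
    also have "\<dots> = nat i" using range(2) by simp
    finally show ?thesis using \<open>i \<noteq> 0\<close> range(2) by simp
  qed simp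
  then have "height (flip (turn e (i + 2) ?g)) = Suc (height ?g)"
    using height_flip by simp
  then show "height (twists e ?js) = length ?js"
    using height_twists_replicate_2[OF e, of k] by (simp add: 1) (simp add: twist_def add.assoc)
  show "length ?js = length is" using len by simp
  show "set ?js \<subseteq> {0..<int e}" using e by auto
qed (use range in auto)

lemma twists_eq_1_0_binary:
  assumes e: "e \<ge> 3" and "twists e is = twists e (1 # replicate k 0)"
    and "length is = Suc k" "set is \<subseteq> {0, 1}"
  shows "is = 1 # replicate k 0"
  using assms(2-)
proof (induction k arbitrary: "is")
  case 0
  show ?case
  proof (rule twists_inject[symmetric])
    show "height (twists e (1 # replicate 0 0)) = length (1 # replicate 0 (0::int))"
      by (simp add: twist_def height_flip)
  qed (use 0 e in auto)
next
  case (Suc k)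
  obtain js i where "is": "is = js @ [i]"
    using Suc.prems(2) by (cases "is" rule: rev_cases) auto
  have 01: "set js \<subseteq> {0, 1}" "i \<in> {0, 1}" using Suc.prems "is" by auto
  show ?case
  proof (cases "i = 0")
    case True
    have "1 # replicate (Suc k) 0 = (1 # replicate k 0) @ [0::int]"
      by (simp add: replicate_append_same)
    then have "twists e (js @ [0]) = twists e ((1 # replicate k 0) @ [0])"
      using Suc.prems(1) "is" True by (simp only:)
    then have "twists e js = twists e (1 # replicate k 0)"
      by (auto dest: twist_inject)
    then have "js = 1 # replicate k 0"
      using Suc.IH 01 Suc.prems(2) "is" by auto
    then show ?thesis using "is" True by (simp add: replicate_append_same)
  next
    case False
    then have "i = 1" using 01 by simp
    have "set js \<subseteq> {0..<int e}" using 01 e by auto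
    then have "js = replicate k 2 @ [(1 + 1) mod int e]"
      using Suc.prems(1,2) e unfolding "is" \<open>i = 1\<close>
      by (intro twists_eq_1_0_last) auto
    then have "js = replicate k 2 @ [2]" using e by simp
    then show ?thesis using 01 e by auto
  qed
qed

lemma twists_eq_1_0:
  assumes e: "e \<ge> 3" and eq: "twists e (is @ js) = twists e (1 # replicate k 0)" and "k \<ge> 2"
    and len: "length (is @ js) = Suc k" and range: "set is \<subseteq> {0, 1}" "set js \<subseteq> {1, 2}"
  shows "is = 1 # replicate k 0 \<and> js = [] \<or> is = [] \<and> js = replicate k 2 @ [1]"
proof (cases js rule: rev_cases)
  case Nil
  then show ?thesis using twists_eq_1_0_binary[OF e, of "is" k] eq len range(1) by auto
next
  case (snoc js' i)
  obtain k' where k: "k = Suc (Suc k')" using \<open>k \<ge> 2\<close> le_Suc_ex[of 2 k] by auto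
  have i: "i \<in> {1, 2}" using range snoc by auto
  have "set (is @ js') \<subseteq> {0..<int e}" "i \<in> {0..<int e}" "i \<noteq> 0"
    using range e i snoc by auto
  then have "is @ js' = replicate (Suc k') 2 @ [(i + 1) mod int e]"
    using eq len e unfolding snoc k by (intro twists_eq_1_0_last) simp_all
  moreover from this have "is = []"
    using range(1) by (cases "is") auto
  ultimately have js': "js' = replicate (Suc k') 2 @ [(i + 1) mod int e]" by simp
  then have "(i + 1) mod int e \<in> {1, 2}" using range snoc by auto
  moreover have "(2 + 1) mod int e \<notin> {1, 2}"
    using e by (cases "e = 3") auto
  ultimately have "i = 1" using i by auto
  then show ?thesis using js' snoc k e \<open>is = []\<close> by (simp add: replicate_append_same)
qed

section \<open>Tracking two strands\<close>

fun site :: "bmr_letter \<Rightarrow> nat" where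
  "site (Tau i) = i"
| "site Tau2' = 2"

definition phase :: "bmr_letter \<Rightarrow> int" where
  "phase l = (if l = Tau 2 then 1 else 0)"

definition swap :: "nat \<Rightarrow> nat \<Rightarrow> nat" where
  "swap k p = (if p = k then k - 1 else if p + 1 = k then k else p)"

text \<open>Positions \<open>p < q\<close> of the two strands, and their relative phase modulo \<open>e\<close>. Only \<open>\<tau>\<^sub>2\<close>, moving
  one strand past an untracked one, changes the phase; here \<open>\<tau>\<^sub>2\<close> and \<open>\<tau>\<^sub>2'\<close> are the generators
  \<open>t\<^sub>1\<close> and \<open>t\<^sub>0\<close> in the presentation of Corran and Picantin.\<close>

type_synonym conf = "nat \<times> nat \<times> nat"

fun crossing :: "bmr_letter \<Rightarrow> conf \<Rightarrow> bool" where
  "crossing l (p, q, f) \<longleftrightarrow> p + 1 = site l \<and> q = site l"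

fun move :: "nat \<Rightarrow> bmr_letter \<Rightarrow> conf \<Rightarrow> conf" where
  "move e l (p, q, f) =
    (if crossing l (p, q, f) then (p, q, f)
     else (swap (site l) p, swap (site l) q,
       rot e (if p = 1 then phase l else if p = 2 then - phase l else 0) f))"

fun label :: "bmr_letter \<Rightarrow> conf \<Rightarrow> int" where
  "label l (p, q, f) = int f + phase l"

fun valid :: "nat \<Rightarrow> conf \<Rightarrow> bool" where
  "valid e (p, q, f) \<longleftrightarrow> p < q \<and> f < e"

text \<open>The two integers count the crossings of the two strands and all other letters.\<close>

type_synonym state = "conf \<times> normal_form \<times> int \<times> int"

fun act :: "nat \<Rightarrow> bmr_letter \<times> bool \<Rightarrow> state \<Rightarrow> state" where
  "act e (l, b) (c, g, n, m) =
    (let d = if b then 1 else - 1 in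
     if crossing l c then (c, (if b then twist else untwist) e (label l c) g, n + d, m)
     else (move e l c, g, n, m + d))"

abbreviation acts :: "nat \<Rightarrow> (bmr_letter \<times> bool) list \<Rightarrow> state \<Rightarrow> state" where
  "acts e \<equiv> fold (act e)"

lemma valid_move: "valid e c \<Longrightarrow> valid e (move e l c)"
  by (cases c) (auto simp: swap_def rot_less)

lemma valid_act: "valid e (fst s) \<Longrightarrow> valid e (fst (act e x s))"
  by (cases s; cases x) (auto simp: Let_def valid_move)

lemma valid_acts: "valid e (fst s) \<Longrightarrow> valid e (fst (acts e w s))"
  by (induction w arbitrary: s) (auto simp: valid_act)

lemma move_move:
  assumes "valid e c" "\<not> crossing l c"
  shows "\<not> crossing l (move e l c) \<and> move e l (move e l c) = c"
proof -
  obtain p q f where c: "c = (p, q, f)" by (cases c)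
  show ?thesis
  proof (cases l)
    case Tau2'
    then show ?thesis using assms by (auto simp: c swap_def phase_def)
  next
    case (Tau i)
    then show ?thesis using assms by (cases "i = 2") (auto simp: c swap_def phase_def)
  qed
qed

lemma act_cancel:
  assumes "valid e (fst s)"
  shows "act e (l, \<not> b) (act e (l, b) s) = s"
proof -
  obtain c g n m where s: "s = (c, g, n, m)" by (cases s)
  show ?thesis
  proof (cases "crossing l c")
    case True
    then show ?thesis by (simp add: s Let_def)
  next
    case False
    then show ?thesis using move_move[of e c l] assms by (simp add: s Let_def)
  qed
qed

definition double_act :: "nat \<Rightarrow> state \<Rightarrow> state" where
  "double_act e s = act e (Tau2', True) (act e (Tau 2, True) s)"

lemma acts_alt_word_even:
  "acts e (pos_word (alt_word (Tau 2) Tau2' (2 * c))) s = (double_act e ^^ c) s"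
  by (induction c arbitrary: s) (simp_all add: double_act_def funpow_swap1)

lemma acts_alt_word_odd:
  "acts e (pos_word (alt_word (Tau 2) Tau2' (Suc (2 * c)))) s = act e (Tau 2, True) ((double_act e ^^ c) s)"
  by (induction c arbitrary: s) (simp_all add: double_act_def funpow_swap1)

lemma double_act_cross [simp]:
  "double_act e ((Suc 0, 2, f), g, n, m) = ((Suc 0, 2, f), turn e 2 g, n + 2, m)"
  using twist_pred_twist[of e "int f" g] by (simp add: double_act_def Let_def phase_def add.commute)

lemma double_act_1 [simp]:
  "q > 2 \<Longrightarrow> double_act e ((Suc 0, q, f), g, n, m) = ((Suc 0, q, rot e 1 f), g, n, m + 2)"
  by (simp add: double_act_def Let_def phase_def swap_def)

lemma double_act_2 [simp]:
  "q > 2 \<Longrightarrow> double_act e ((2, q, f), g, n, m) = ((2, q, rot e (- 1) f), g, n, m + 2)"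
  by (simp add: double_act_def Let_def phase_def swap_def)

lemma double_act_else [simp]:
  "p < q \<Longrightarrow> p \<noteq> 1 \<Longrightarrow> p \<noteq> 2 \<Longrightarrow> double_act e ((p, q, f), g, n, m) = ((p, q, f), g, n, m + 2)"
  by (auto simp add: double_act_def Let_def phase_def swap_def)

lemma double_act_pow:
  "(double_act e ^^ c) ((Suc 0, 2, f), g, n, m) = ((Suc 0, 2, f), turn e (2 * int c) g, n + 2 * int c, m)"
  "q > 2 \<Longrightarrow> (double_act e ^^ c) ((Suc 0, q, f), g, n, m) = ((Suc 0, q, rot e (int c) f), g, n, m + 2 * int c)"
  "q > 2 \<Longrightarrow> (double_act e ^^ c) ((2, q, f), g, n, m) = ((2, q, rot e (- int c) f), g, n, m + 2 * int c)"
  "p < q \<Longrightarrow> p \<noteq> 1 \<Longrightarrow> p \<noteq> 2 \<Longrightarrow>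
    (double_act e ^^ c) ((p, q, f), g, n, m) = ((p, q, f), g, n, m + 2 * int c)"
  by (induction c) (simp_all add: algebra_simps)

lemma conf_cases:
  assumes "valid e (fst s)"
  obtains (cross) f g n m where "s = ((Suc 0, 2, f), g, n, m)"
  | (one) q f g n m where "s = ((Suc 0, q, f), g, n, m)" "q > 2"
  | (two) q f g n m where "s = ((2, q, f), g, n, m)" "q > 2"
  | (else) p q f g n m where "s = ((p, q, f), g, n, m)" "p < q" "p \<noteq> 1" "p \<noteq> 2"
proof -
  obtain p q f g n m where s: "s = ((p, q, f), g, n, m)" by (cases s) auto
  show thesis
  proof (cases "p = 1")
    case True
    then show ?thesis using assms s cross[of f g n m] one[of q f g n m] by (cases "q = 2") auto
  next
    case False
    then show ?thesis using assms s two[of q f g n m] else[of p q f g n m] by (cases "p = 2") auto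
  qed
qed

lemma acts_alt_word:
  assumes "valid e (fst s)"
  shows "acts e (pos_word (alt_word (Tau 2) Tau2' e)) s = acts e (pos_word (alt_word Tau2' (Tau 2) e)) s"
proof (cases "even e")
  case True
  show ?thesis
  proof (cases "e = 0")
    case False
    then obtain c where e: "e = Suc (Suc (2 * c))" using True
      by (metis dvd_def even_Suc odd_Suc_minus_one not0_implies_Suc mult_Suc_right add_2_eq_Suc)
    have L: "acts e (pos_word (alt_word (Tau 2) Tau2' e)) s = (double_act e ^^ Suc c) s"
      using acts_alt_word_even[of e "Suc c" s] by (simp add: e)
    have R: "acts e (pos_word (alt_word Tau2' (Tau 2) e)) s =
        act e (Tau 2, True) ((double_act e ^^ c) (act e (Tau2', True) s))"
      using acts_alt_word_odd[of e c "act e (Tau2', True) s"] unfolding e by simp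
    have full: "turn e (2 * int (Suc c)) g = g" for g
      using turn_cong[of "2 * int (Suc c)" e 0 g] by (simp add: e)
    have half: "rot e (int (Suc c)) f = rot e (- int (Suc c)) f" for f
      by (rule rot_cong, simp only: mod_eq_dvd_iff) (simp add: e algebra_simps)
    from assms show ?thesis unfolding L R double_act_pow
    proof (cases rule: conf_cases)
      case (cross f g n m)
      have "twist e (int f + 1) (turn e (2 * int c) (twist e (int f) g)) =
          turn e (2 * int c) (twist e (int f + 1 + 2 * int c) (twist e (int f) g))"
        by (simp add: twist_turn)
      also have "twist e (int f + 1 + 2 * int c) h = twist e (int f - 1) h" for h
        by (rule twist_cong) (simp add: e mod_eq_dvd_iff)
      also have "turn e (2 * int c) (twist e (int f - 1) (twist e (int f) g)) = g"
        using twist_pred_twist[of e "int f - 1" g] full[of g] by (simp add: algebra_simps)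
      finally show "(double_act e ^^ Suc c) s = act e (Tau 2, True) ((double_act e ^^ c) (act e (Tau2', True) s))"
        unfolding cross(1) double_act_pow full by (simp add: Let_def phase_def double_act_pow)
    next
      case (one q f g n m)
      then show "(double_act e ^^ Suc c) s = act e (Tau 2, True) ((double_act e ^^ c) (act e (Tau2', True) s))"
        unfolding one(1) double_act_pow(2)[OF one(2)] half
        by (simp add: Let_def phase_def double_act_pow swap_def)
    next
      case (two q f g n m)
      then show "(double_act e ^^ Suc c) s = act e (Tau 2, True) ((double_act e ^^ c) (act e (Tau2', True) s))"
        unfolding two(1) double_act_pow(3)[OF two(2)] half[symmetric]
        by (simp add: Let_def phase_def double_act_pow swap_def add.commute)
    next
      case (else p q f g n m)
      then show "(double_act e ^^ Suc c) s = act e (Tau 2, True) ((double_act e ^^ c) (act e (Tau2', True) s))"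
        unfolding else(1) double_act_pow(4)[OF else(2-4)]
        by (auto simp add: Let_def phase_def double_act_pow swap_def)
    qed
  qed simp
next
  case False
  then obtain c where e: "e = Suc (2 * c)" by (metis oddE Suc_eq_plus1)
  have L: "acts e (pos_word (alt_word (Tau 2) Tau2' e)) s = act e (Tau 2, True) ((double_act e ^^ c) s)"
    using acts_alt_word_odd[of e c s] by (simp only: e)
  have R: "acts e (pos_word (alt_word Tau2' (Tau 2) e)) s = (double_act e ^^ c) (act e (Tau2', True) s)"
    using acts_alt_word_even[of e c "act e (Tau2', True) s"] unfolding e by simp
  have half: "rot e (int c + 1) f = rot e (- int c) f" for f
    by (rule rot_cong, simp only: mod_eq_dvd_iff) (simp add: e algebra_simps)
  have half': "rot e (- 1 - int c) f = rot e (int c) f" for f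
    by (rule rot_cong[symmetric], simp only: mod_eq_dvd_iff) (simp add: e algebra_simps)
  from assms show ?thesis unfolding L R
  proof (cases rule: conf_cases)
    case (cross f g n m)
    have "twist e (int f + 1) (turn e (2 * int c) g) = turn e (2 * int c) (twist e (int f + 1 + 2 * int c) g)"
      by (simp add: twist_turn)
    also have "twist e (int f + 1 + 2 * int c) g = twist e (int f) g"
      by (rule twist_cong) (simp add: e mod_eq_dvd_iff)
    finally show "act e (Tau 2, True) ((double_act e ^^ c) s) = (double_act e ^^ c) (act e (Tau2', True) s)"
      unfolding cross(1) by (simp add: Let_def phase_def double_act_pow)
  next
    case (one q f g n m)
    then show "act e (Tau 2, True) ((double_act e ^^ c) s) = (double_act e ^^ c) (act e (Tau2', True) s)"
      using half by (simp add: Let_def phase_def double_act_pow swap_def add.commute)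
  next
    case (two q f g n m)
    then show "act e (Tau 2, True) ((double_act e ^^ c) s) = (double_act e ^^ c) (act e (Tau2', True) s)"
      using half' by (simp add: Let_def phase_def double_act_pow swap_def)
  next
    case (else p q f g n m)
    then show "act e (Tau 2, True) ((double_act e ^^ c) s) = (double_act e ^^ c) (act e (Tau2', True) s)"
      by (auto simp add: Let_def phase_def double_act_pow swap_def)
  qed
qed

lemma twist_rot: "f < e \<Longrightarrow> twist e (int (rot e a f) + b) g = twist e (int f + (a + b)) g"
  by (rule twist_cong) (simp add: rot_def mod_simps add.assoc)

lemma twist_rot_0: "f < e \<Longrightarrow> twist e (int (rot e a f)) g = twist e (int f + a) g"
  using twist_rot[of f e a 0 g] by simp

lemma acts_commute:
  assumes "valid e (fst s)" "site k \<ge> 2" "site l \<ge> site k + 2"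
  shows "act e (k, True) (act e (l, True) s) = act e (l, True) (act e (k, True) s)"
proof -
  obtain p q f g n m where s: "s = ((p, q, f), g, n, m)" by (cases s) auto
  have l: "phase l = 0" using assms by (auto simp: phase_def)
  define i d where "i = site k - 1" and "d = site l - site k - 1"
  then have i: "site k = Suc i" "i \<ge> 1" "site l = Suc (Suc (i + d))" "d \<ge> 1"
    using assms(2,3) by auto
  have "p = i \<or> p = Suc i \<or> p = Suc (i + d) \<or> p = Suc (Suc (i + d)) \<or>
      p \<notin> {i, Suc i, Suc (i + d), Suc (Suc (i + d))}"
    "q = i \<or> q = Suc i \<or> q = Suc (i + d) \<or> q = Suc (Suc (i + d)) \<or>
      q \<notin> {i, Suc i, Suc (i + d), Suc (Suc (i + d))}" by auto
  moreover have "p < q" using assms(1) s by simp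
  ultimately show ?thesis
    using i(2,4) by (elim disjE) (simp_all add: s l Let_def swap_def i(1,3))
qed

lemma acts_braid:
  assumes "valid e (fst s)" "site k \<ge> 2" "site l = site k + 1" 
  shows "act e (k, True) (act e (l, True) (act e (k, True) s)) = act e (l, True) (act e (k, True) (act e (l, True) s))"
proof -
  obtain p q f g n m where s: "s = ((p, q, f), g, n, m)" by (cases s) auto
  have l: "phase l = 0" using assms by (auto simp: phase_def)
  have pq: "p < q" and f: "f < e" using assms(1) s by simp_all
  obtain i where i: "site k = Suc i" "i \<ge> 1" "site l = Suc (Suc i)"
    using assms(2,3) by (cases "site k") auto
  have *: "p = i \<or> p = Suc i \<or> p = Suc (Suc i) \<or> p \<notin> {i, Suc i, Suc (Suc i)}"
    "q = i \<or> q = Suc i \<or> q = Suc (Suc i) \<or> q \<notin> {i, Suc i, Suc (Suc i)}" by auto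
  show ?thesis
  proof (cases "i = 1")
    case True
    show ?thesis
      using * pq f by (elim disjE) (simp_all add: True s l Let_def swap_def i(1,3) twist_rot twist_rot_0)
  next
    case False
    then have k: "phase k = 0" using i by (auto simp: phase_def)
    show ?thesis
      using * pq f False i(2) by (elim disjE) (simp_all add: s l k Let_def swap_def i(1,3))
  qed
qed

lemma acts_commuting_square:
  assumes "valid e (fst s)"
  shows "acts e (pos_word [Tau 3, Tau 2, Tau2', Tau 3, Tau 2, Tau2']) s =
    acts e (pos_word [Tau 2, Tau2', Tau 3, Tau 2, Tau2', Tau 3]) s"
proof -
  obtain p q f g n m where s: "s = ((p, q, f), g, n, m)" by (cases s) auto
  have pq: "p < q" and f: "f < e" using assms(1) s by simp_all
  have *: "p = 1 \<or> p = 2 \<or> p = 3 \<or> p \<notin> {1, 2, 3}"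
    "q = 1 \<or> q = 2 \<or> q = 3 \<or> q \<notin> {1, 2, 3}" by auto
  have d: "act e (Tau2', True) (act e (Tau 2, True) t) = double_act e t" for t
    by (simp add: double_act_def)
  show ?thesis
    using * pq f twist_pred_twist[of e "int f - 2" g] twist_pred_twist[of e "int f - 1" g]
    by (elim disjE)
      (simp_all del: act.simps add: s d, simp_all add: Let_def phase_def swap_def twist_rot_0)
qed

lemma acts_bmr_relations:
  assumes "(u, v) \<in> bmr_relations e r" "valid e (fst s)"
  shows "acts e (pos_word u) s = acts e (pos_word v) s"
  using assms(1)
proof cases
  case (1 i j)
  then show ?thesis
    using acts_commute[OF assms(2), of "Tau i" "Tau j"] acts_commute[OF assms(2), of "Tau j" "Tau i"]
    by (cases "i \<le> j") (simp_all del: act.simps)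
next
  case (2 j)
  then show ?thesis
    using acts_commute[OF assms(2), of Tau2' "Tau j"] by (simp del: act.simps)
next
  case 3
  then show ?thesis using acts_alt_word[OF assms(2)] by simp
next
  case (4 i)
  then show ?thesis using acts_braid[OF assms(2), of "Tau i" "Tau (i + 1)"] by (simp del: act.simps)
next
  case 5
  then show ?thesis using acts_braid[OF assms(2), of Tau2' "Tau 3"] by (simp del: act.simps)
next
  case 6
  then show ?thesis using acts_commuting_square[OF assms(2)] by (simp only:)
qed

lemma acts_word_cong:
  assumes "word_cong (bmr_group_relations e r \<union> cancellations A) U V" "valid e (fst s)"
  shows "acts e U s = acts e V s"
  using assms
proof (induction arbitrary: s)
  case (rel U V)
  from rel.hyps show ?case
  proof
    assume "(U, V) \<in> bmr_group_relations e r"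
    then obtain u v where "U = pos_word u" "V = pos_word v" "(u, v) \<in> bmr_relations e r"
      by (auto simp: bmr_group_relations_def)
    then show ?thesis using acts_bmr_relations rel.prems by blast
next
    assume "(U, V) \<in> cancellations A"
    then obtain a b where "U = [(a, b), (a, \<not> b)]" "V = []"
      by (auto simp: cancellations_def)
    then show ?thesis using act_cancel[OF rel.prems] by simp
  qed
next
  case (append U V U' V')
  then show ?case using valid_acts[OF append.prems, of V] by simp
qed simp_all

fun emits :: "nat \<Rightarrow> bmr_letter list \<Rightarrow> conf \<Rightarrow> int list" where
  "emits e [] c = []"
| "emits e (l # w) c = (if crossing l c then [label l c] else []) @ emits e w (move e l c)"

fun spare :: "nat \<Rightarrow> bmr_letter list \<Rightarrow> conf \<Rightarrow> nat" where
  "spare e [] c = 0"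
| "spare e (l # w) c = (if crossing l c then 0 else 1) + spare e w (move e l c)"

lemma acts_pos_word:
  "acts e (pos_word w) (c, g, n, m) =
    (fold (move e) w c, fold (twist e) (emits e w c) g,
     n + int (length (emits e w c)), m + int (spare e w c))"
proof (induction w arbitrary: c g n m)
  case (Cons l w)
  have "crossing l c \<Longrightarrow> move e l c = c" by (cases c) simp
  then show ?case by (simp add: Cons Let_def)
qed simp

lemma length_emits_spare: "length (emits e w c) + spare e w c = length w"
  by (induction w arbitrary: c) auto

lemma emits_append: "emits e (v @ w) c = emits e v c @ emits e w (fold (move e) v c)"
  by (induction v arbitrary: c) auto

text \<open>Every other letter changes \<open>p + q\<close> by at most 1, and the phase changes only when the lower
  strand moves between the positions 1 and 2 while the upper one is at 3 or above.\<close>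

lemma spare_bound:
  assumes "fold (move e) w (p, q, f) = (1, 2, f')" "\<forall>l\<in>set w. site l \<ge> 2" "1 \<le> p" "p < q"
  shows "p + q \<le> spare e w (p, q, f) + 3 \<and>
    (p = 1 \<and> f \<noteq> f' \<longrightarrow> (if q = 2 then 4 else q) \<le> spare e w (p, q, f))"
  using assms
proof (induction w arbitrary: p q f)
  case (Cons l w)
  obtain p1 q1 f1 where m: "move e l (p, q, f) = (p1, q1, f1)" by (metis prod_cases3)
  have l: "site l \<ge> 2" using Cons.prems by simp
  then have 1: "1 \<le> p1" "p1 < q1"
    using m Cons.prems by (auto simp: swap_def split: if_splits)
  have IH: "p1 + q1 \<le> spare e w (p1, q1, f1) + 3"
    "p1 = 1 \<Longrightarrow> f1 \<noteq> f' \<Longrightarrow> (if q1 = 2 then 4 else q1) \<le> spare e w (p1, q1, f1)"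
    using Cons.IH[of p1 q1 f1] Cons.prems m 1 by auto
  show ?case
  proof (cases "crossing l (p, q, f)")
    case True
    then show ?thesis using IH m by simp
  next
    case False
    have ph: "phase l = 0" if "site l \<noteq> 2" using that by (auto simp: phase_def)
    have sw: "p1 = swap (site l) p" "q1 = swap (site l) q" "site l \<noteq> 2 \<Longrightarrow> f1 = f"
      using m False ph by auto
    have near: "p + q \<le> p1 + q1 + 1" "q \<le> q1 + 1"
      using sw False Cons.prems(4) by (auto simp: swap_def)
    have "(if q = 2 then 4 else q) \<le> Suc (spare e w (p1, q1, f1))" if "p = 1" "f \<noteq> f'"
    proof (cases "site l = 2")
      case True
      then have "p1 = 2" "q1 = q" "q \<noteq> 2"
        using sw False that(1) Cons.prems(4) by (auto simp: swap_def)
      then show ?thesis using IH(1) by simp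
    next
      case False
      then have "p1 = 1" "f1 \<noteq> f'" using sw that l by (auto simp: swap_def)
      then have "(if q1 = 2 then 4 else q1) \<le> spare e w (p1, q1, f1)" by (rule IH(2))
      then show ?thesis using near(2) 1 \<open>p1 = 1\<close> by (cases "q1 = 2"; cases "q = 2") simp_all
    qed
    moreover have "spare e (l # w) (p, q, f) = Suc (spare e w (p1, q1, f1))"
      using False m by (simp del: move.simps crossing.simps)
    ultimately show ?thesis using IH(1) near(1) by (auto simp del: spare.simps)
  qed
qed simp

lemma site_2_iff: "site l = 2 \<longleftrightarrow> l = Tau 2 \<or> l = Tau2'"
  by (cases l) auto

lemma site_3_iff: "site l = 3 \<longleftrightarrow> l = Tau 3"
  by (cases l) auto

lemma moves_site_2:
  assumes "\<forall>l\<in>set w. site l = 2"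
  shows "fold (move e) w (1, 2, f) = (1, 2, f)" "spare e w (1, 2, f) = 0"
    "emits e w (1, 2, f) = map (\<lambda>l. int f + phase l) w"
  using assms by (induction w) auto

lemma site_2_if_spare_0:
  assumes "spare e w (1, 2, f) = 0" "\<forall>l\<in>set w. site l \<ge> 2"
  shows "\<forall>l\<in>set w. site l = 2"
  using assms by (induction w) (auto split: if_splits)

lemma site_cases:
  assumes "site l \<ge> 2"
  obtains "site l = 2" | "l = Tau 3" | "site l = 4" | "site l \<ge> 5"
  using assms site_3_iff[of l] by fastforce

lemma first_step:
  assumes "fold (move e) w (1, 2, 0) = (1, 2, 1)" "spare e w (1, 2, 0) = 4" "\<forall>l\<in>set w. site l \<ge> 2"
  shows "\<exists>v w'. w = v @ Tau 3 # w' \<and> (\<forall>l\<in>set v. site l = 2) \<and>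
    fold (move e) w' (1, 3, 0) = (1, 2, 1) \<and> spare e w' (1, 3, 0) = 3"
  using assms
proof (induction w)
  case (Cons l w)
  have l: "site l \<ge> 2" and w: "\<forall>l\<in>set w. site l \<ge> 2" using Cons.prems by auto
  show ?case
  proof (cases rule: site_cases[OF l])
    case 1
    then have "\<exists>v w'. w = v @ Tau 3 # w' \<and> (\<forall>l\<in>set v. site l = 2) \<and>
        fold (move e) w' (1, 3, 0) = (1, 2, 1) \<and> spare e w' (1, 3, 0) = 3"
      using Cons by auto
    then obtain v w' where "w = v @ Tau 3 # w'" "\<forall>l\<in>set v. site l = 2"
        "fold (move e) w' (1, 3, 0) = (1, 2, 1)" "spare e w' (1, 3, 0) = 3" by blast
    then show ?thesis using 1 by (intro exI[of _ "l # v"] exI[of _ w']) auto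
  next
    case 2
    then show ?thesis using Cons.prems
      by (intro exI[of _ "[]"] exI[of _ w]) (simp add: swap_def phase_def)
  next
    case 3
    then have "move e l (1, 2, 0) = (1, 2, 0)" "\<not> crossing l (1, 2, 0)"
      by (auto simp: swap_def phase_def)
    then show ?thesis using spare_bound[of e w 1 2 0 1] Cons.prems w by (simp del: move.simps crossing.simps)
  next
    case 4
    then have "move e l (1, 2, 0) = (1, 2, 0)" "\<not> crossing l (1, 2, 0)"
      by (auto simp: swap_def phase_def)
    then show ?thesis using spare_bound[of e w 1 2 0 1] Cons.prems w by (simp del: move.simps crossing.simps)
  qed
qed simp

lemma second_step:
  assumes "fold (move e) w (1, 3, 0) = (1, 2, 1)" "spare e w (1, 3, 0) = 3" "\<forall>l\<in>set w. site l \<ge> 2"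
  shows "\<exists>a w'. w = a # w' \<and> site a = 2 \<and>
    fold (move e) w' (2, 3, rot e (phase a) 0) = (1, 2, 1) \<and> spare e w' (2, 3, rot e (phase a) 0) = 2"
proof (cases w)
  case (Cons l w')
  have l: "site l \<ge> 2" and w: "\<forall>l\<in>set w'. site l \<ge> 2" using assms Cons by auto
  show ?thesis
  proof (cases rule: site_cases[OF l])
    case 1
    then show ?thesis using assms Cons by (simp add: swap_def)
  next
    case 2
    then have "move e l (1, 3, 0) = (1, 2, 0)" "\<not> crossing l (1, 3, 0)"
      by (auto simp: swap_def phase_def)
    then show ?thesis using spare_bound[of e w' 1 2 0 1] assms Cons w by (simp del: move.simps crossing.simps)
  next
    case 3
    then have "move e l (1, 3, 0) = (1, 4, 0)" "\<not> crossing l (1, 3, 0)"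
      by (auto simp: swap_def phase_def)
    then show ?thesis using spare_bound[of e w' 1 4 0 1] assms Cons w by (simp del: move.simps crossing.simps)
  next
    case 4
    then have "move e l (1, 3, 0) = (1, 3, 0)" "\<not> crossing l (1, 3, 0)"
      by (auto simp: swap_def phase_def)
    then show ?thesis using spare_bound[of e w' 1 3 0 1] assms Cons w by (simp del: move.simps crossing.simps)
  qed
qed (use assms in simp)

lemma third_step:
  assumes "fold (move e) w (2, 3, f) = (1, 2, 1)" "spare e w (2, 3, f) = 2" "\<forall>l\<in>set w. site l \<ge> 2"
  shows "\<exists>j b w'. w = replicate j (Tau 3) @ b # w' \<and> site b = 2 \<and>
    fold (move e) w' (1, 3, rot e (- phase b) f) = (1, 2, 1) \<and> spare e w' (1, 3, rot e (- phase b) f) = 1"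
  using assms
proof (induction w)
  case (Cons l w)
  have l: "site l \<ge> 2" and w: "\<forall>l\<in>set w. site l \<ge> 2" using Cons.prems by auto
  show ?case
  proof (cases rule: site_cases[OF l])
    case 1
    then show ?thesis using Cons.prems
      by (intro exI[of _ 0] exI[of _ l] exI[of _ w]) (simp add: swap_def)
  next
    case 2
    then have "move e l (2, 3, f) = (2, 3, f)" "crossing l (2, 3, f)" by auto
    then have "\<exists>j b w'. w = replicate j (Tau 3) @ b # w' \<and> site b = 2 \<and>
        fold (move e) w' (1, 3, rot e (- phase b) f) = (1, 2, 1) \<and> spare e w' (1, 3, rot e (- phase b) f) = 1"
      using Cons by (simp del: move.simps crossing.simps)
    then obtain j b w' where *: "w = replicate j (Tau 3) @ b # w'" "site b = 2"
        "fold (move e) w' (1, 3, rot e (- phase b) f) = (1, 2, 1)"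
        "spare e w' (1, 3, rot e (- phase b) f) = 1" by blast
    then have "l # w = replicate (Suc j) (Tau 3) @ b # w'" using 2 by simp
    then show ?thesis using *(2-) by blast
  next
    case 3
    then have "move e l (2, 3, f) = (2, 4, f)" "\<not> crossing l (2, 3, f)"
      by (auto simp: swap_def phase_def)
    then show ?thesis using spare_bound[of e w 2 4 f 1] Cons.prems w by (simp del: move.simps crossing.simps)
  next
    case 4
    then have "move e l (2, 3, f) = (2, 3, f)" "\<not> crossing l (2, 3, f)"
      by (auto simp: swap_def phase_def)
    then show ?thesis using spare_bound[of e w 2 3 f 1] Cons.prems w by (simp del: move.simps crossing.simps)
  qed
qed simp

lemma fourth_step:
  assumes "fold (move e) w (1, 3, f) = (1, 2, 1)" "spare e w (1, 3, f) = 1" "\<forall>l\<in>set w. site l \<ge> 2"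
  shows "f = 1 \<and> (\<exists>v. w = Tau 3 # v \<and> (\<forall>l\<in>set v. site l = 2))"
proof (cases w)
  case (Cons l w')
  have l: "site l \<ge> 2" and w: "\<forall>l\<in>set w'. site l \<ge> 2" using assms Cons by auto
  show ?thesis
  proof (cases rule: site_cases[OF l])
    case 1
    then have "move e l (1, 3, f) = (2, 3, rot e (phase l) f)" "\<not> crossing l (1, 3, f)"
      by (auto simp: swap_def)
    then show ?thesis using spare_bound[of e w' 2 3 "rot e (phase l) f" 1] assms Cons w
      by (simp del: move.simps crossing.simps)
  next
    case 2
    then have m: "move e l (1, 3, f) = (1, 2, f)" "\<not> crossing l (1, 3, f)"
      by (auto simp: swap_def phase_def)
    then have "spare e w' (1, 2, f) = 0" using assms(2) Cons by (simp del: move.simps crossing.simps)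
    then have v: "\<forall>l\<in>set w'. site l = 2" using site_2_if_spare_0 w by blast
    then have "f = 1"
      using moves_site_2(1)[of w' e f] assms(1) Cons m by (simp del: move.simps crossing.simps)
    then show ?thesis using 2 v Cons by simp
  next
    case 3
    then have "move e l (1, 3, f) = (1, 4, f)" "\<not> crossing l (1, 3, f)"
      by (auto simp: swap_def phase_def)
    then show ?thesis using spare_bound[of e w' 1 4 f 1] assms Cons w by (simp del: move.simps crossing.simps)
  next
    case 4
    then have "move e l (1, 3, f) = (1, 3, f)" "\<not> crossing l (1, 3, f)"
      by (auto simp: swap_def phase_def)
    then show ?thesis using spare_bound[of e w' 1 3 f 1] assms Cons w by (simp del: move.simps crossing.simps)
  qed
qed (use assms in simp)

lemma excursion:
  assumes e: "e \<ge> 3" and "fold (move e) w (1, 2, 0) = (1, 2, 1)" "spare e w (1, 2, 0) = 4"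
    "\<forall>l\<in>set w. site l \<ge> 2"
  obtains v j v' where "w = v @ [Tau 3, Tau 2] @ replicate j (Tau 3) @ [Tau2', Tau 3] @ v'"
    "\<forall>l\<in>set v. site l = 2" "\<forall>l\<in>set v'. site l = 2"
    "emits e w (1, 2, 0) = map phase v @ replicate j 1 @ map (\<lambda>l. 1 + phase l) v'"
proof -
  obtain v w1 where 1: "w = v @ Tau 3 # w1" "\<forall>l\<in>set v. site l = 2"
    "fold (move e) w1 (1, 3, 0) = (1, 2, 1)" "spare e w1 (1, 3, 0) = 3"
    using first_step[OF assms(2-4)] by blast
  obtain a w2 where 2: "w1 = a # w2" "site a = 2"
    "fold (move e) w2 (2, 3, rot e (phase a) 0) = (1, 2, 1)" "spare e w2 (2, 3, rot e (phase a) 0) = 2"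
    using second_step[OF 1(3,4)] assms(4) 1(1) by auto
  obtain j b w3 where 3: "w2 = replicate j (Tau 3) @ b # w3" "site b = 2"
    "fold (move e) w3 (1, 3, rot e (- phase b) (rot e (phase a) 0)) = (1, 2, 1)"
    "spare e w3 (1, 3, rot e (- phase b) (rot e (phase a) 0)) = 1"
    using third_step[OF 2(3,4)] assms(4) 1(1) 2(1) by auto
  obtain v' where 4: "rot e (- phase b) (rot e (phase a) 0) = 1" "w3 = Tau 3 # v'" "\<forall>l\<in>set v'. site l = 2"
    using fourth_step[OF 3(3,4)] assms(4) 1(1) 2(1) 3(1) by auto
  have "rot e (- 1) 0 \<noteq> 1" using e by (simp add: rot_def zmod_zminus1_eq_if)
  then have ab: "a = Tau 2" "b = Tau2'"
    using 4(1) 2(2) 3(2) by (auto simp: site_2_iff phase_def)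
  have rep: "fold (move e) (replicate j (Tau 3)) (2, 3, f) = (2, 3, f)"
    "emits e (replicate j (Tau 3)) (2, 3, f) = replicate j (int f)" for f
    by (induction j) (simp_all add: phase_def)
  have f: "rot e 1 0 = 1" using e by (simp add: rot_def)
  have w: "w = v @ [Tau 3, Tau 2] @ replicate j (Tau 3) @ [Tau2', Tau 3] @ v'"
    using 1 2 3 4 ab by simp
  moreover have "emits e w (1, 2, 0) = map phase v @ replicate j 1 @ map (\<lambda>l. 1 + phase l) v'"
    using moves_site_2[OF 1(2), of e 0] moves_site_2(3)[OF 4(3), of e 1] f
    unfolding w by (simp add: emits_append rep swap_def phase_def)
  ultimately show thesis using that 1(2) 4(3) by blast
qed

definition left_word :: "nat \<Rightarrow> bmr_letter list" where
  "left_word k = Tau 2 # replicate k Tau2' @ [Tau 3, Tau 2, Tau2', Tau 3]"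

definition right_word :: "nat \<Rightarrow> bmr_letter list" where
  "right_word k = [Tau 3, Tau 2, Tau2', Tau 3] @ replicate k (Tau 2) @ [Tau2']"

lemma inj_on_phase: "inj_on phase {l. site l = 2}" "inj_on (\<lambda>l. 1 + phase l) {l. site l = 2}"
  by (auto simp: inj_on_def phase_def site_2_iff)

lemma eq_left_word_or_right_word:
  assumes e: "e \<ge> 3" and k: "k \<ge> 2" and w: "\<forall>l\<in>set w. site l \<ge> 2"
    and "word_cong (bmr_group_relations e r \<union> cancellations A) (pos_word w) (pos_word (left_word k))"
  shows "w = left_word k \<or> w = right_word k"
proof -
  let ?s = "((1, 2, 0), (False, 0, []), 0, 0) :: state"
  let ?v = "Tau 2 # replicate k Tau2'"
  have site: "\<forall>l\<in>set ?v. site l = 2" by simp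
  have f: "rot e 1 0 = 1" using e by (simp add: rot_def)
  have l: "left_word k = ?v @ [Tau 3, Tau 2, Tau2', Tau 3]" by (simp add: left_word_def)
  have left: "fold (move e) (left_word k) (1, 2, 0) = (1, 2, 1)" "spare e (left_word k) (1, 2, 0) = 4"
    "emits e (left_word k) (1, 2, 0) = 1 # replicate k 0"
  proof -
    show fin: "fold (move e) (left_word k) (1, 2, 0) = (1, 2, 1)"
      unfolding l fold_append o_apply moves_site_2(1)[OF site]
      by (simp add: swap_def phase_def f)
    show em: "emits e (left_word k) (1, 2, 0) = 1 # replicate k 0"
      unfolding l emits_append moves_site_2[OF site]
      by (simp add: swap_def phase_def)
    show "spare e (left_word k) (1, 2, 0) = 4"
      using length_emits_spare[of e "left_word k" "(1, 2, 0)"] unfolding em by (simp add: left_word_def)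
  qed
  have "acts e (pos_word w) ?s = acts e (pos_word (left_word k)) ?s"
    using assms(4) by (rule acts_word_cong) (use e in simp)
  then have fin: "fold (move e) w (1, 2, 0) = (1, 2, 1)" and sp: "spare e w (1, 2, 0) = 4"
    and tw: "twists e (emits e w (1, 2, 0)) = twists e (1 # replicate k 0)"
    and len: "length (emits e w (1, 2, 0)) = Suc k"
    unfolding acts_pos_word left by (simp_all del: fold_simps)
  obtain v j v' where w: "w = v @ [Tau 3, Tau 2] @ replicate j (Tau 3) @ [Tau2', Tau 3] @ v'"
    and v: "\<forall>l\<in>set v. site l = 2" "\<forall>l\<in>set v'. site l = 2"
    and em: "emits e w (1, 2, 0) = map phase v @ replicate j 1 @ map (\<lambda>l. 1 + phase l) v'"
    using excursion[OF e fin sp w] by blast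
  have "set (map phase v) \<subseteq> {0, 1}" "set (replicate j 1 @ map (\<lambda>l. 1 + phase l) v') \<subseteq> {1, 2}"
    by (auto simp: phase_def split: if_splits)
  from twists_eq_1_0[OF e tw[unfolded em] k len[unfolded em] this]
  show ?thesis
  proof (elim disjE conjE)
    assume "map phase v = 1 # replicate k 0" "replicate j 1 @ map (\<lambda>l. 1 + phase l) v' = []"
    then have m: "map phase v = map phase ?v" and "j = 0" "v' = []"
      by (auto simp: phase_def)
    moreover have "v = ?v"
      by (rule map_inj_on[OF m inj_on_subset[OF inj_on_phase(1)]]) (use v site in auto)
    ultimately show ?thesis using w l by simp
  next
    let ?v' = "replicate k (Tau 2) @ [Tau2']"
    assume "map phase v = []" and *: "replicate j 1 @ map (\<lambda>l. 1 + phase l) v' = replicate k 2 @ [1]"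
    then have "v = []" "j = 0" using k by (auto simp: numeral_2_eq_2 dest!: Suc_le_D) (cases j; simp)
    have "map (\<lambda>l. 1 + phase l) ?v' = replicate k 2 @ [1]" by (simp add: phase_def)
    then have m: "map (\<lambda>l. 1 + phase l) v' = map (\<lambda>l. 1 + phase l) ?v'"
      using * \<open>j = 0\<close> by simp
    have "v' = ?v'"
      by (rule map_inj_on[OF m inj_on_subset[OF inj_on_phase(2)]]) (use v in auto)
    with \<open>v = []\<close> \<open>j = 0\<close> show ?thesis using w by (simp add: right_word_def)
  qed
qed

section \<open>Finite presentations over a given generating set\<close>

lemma word_cong_context:
  assumes "word_cong R x y" and "\<And>l r p q. (l, r) \<in> R \<Longrightarrow> P (p @ l @ q) \<longleftrightarrow> P (p @ r @ q)"
  shows "P (p @ x @ q) \<longleftrightarrow> P (p @ y @ q)"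
  using assms(1)
proof (induction arbitrary: p q)
  case (append u v u' v')
  have "P (p @ (u @ u') @ q) \<longleftrightarrow> P (p @ v @ (u' @ q))"
    using append.IH(1)[of p "u' @ q"] by simp
  also have "\<dots> \<longleftrightarrow> P (p @ (v @ v') @ q)"
    using append.IH(2)[of "p @ v" q] by simp
  finally show ?case .
qed (simp_all add: assms(2))

lemma finitely_presented_monoid_over_generators:
  fixes cls :: "'l list \<Rightarrow> 'm"
  assumes fp: "finitely_presented_monoid M" and "finite L"
    and carrier: "carrier M = cls ` lists L"
    and mult: "\<And>u v. u \<in> lists L \<Longrightarrow> v \<in> lists L \<Longrightarrow> cls (u @ v) = cls u \<otimes>\<^bsub>M\<^esub> cls v"
    and idem: "\<And>x. x \<in> carrier M \<Longrightarrow> x \<otimes>\<^bsub>M\<^esub> x = x \<Longrightarrow> x = cls []"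
  shows "\<exists>T. finite T \<and> T \<subseteq> {(u, v) \<in> lists L \<times> lists L. cls u = cls v} \<and>
    (\<forall>(u, v) \<in> lists L \<times> lists L. cls u = cls v \<longrightarrow> word_cong T u v)"
proof -
  obtain A :: "nat set" and R where AR: "finite A" "finite R" "R \<subseteq> lists A \<times> lists A"
    and "presented_monoid A R \<cong> M"
    using fp unfolding finitely_presented_monoid_def by blast
  then obtain \<phi> where \<phi>: "\<phi> \<in> iso (presented_monoid A R) M" unfolding is_iso_def by auto
  define c where "c w = word_rel A R `` {w}" for w
  have cN: "carrier (presented_monoid A R) = c ` lists A"
    unfolding carrier_presented_monoid c_def quotient_def by auto
  have c_append: "c (u @ v) = c u \<otimes>\<^bsub>presented_monoid A R\<^esub> c v" if "u \<in> lists A" "v \<in> lists A" for u v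
    using that by (simp add: c_def mult_presented_monoid)
  have c_eq: "c u = c v \<longleftrightarrow> word_cong R u v" if "u \<in> lists A" "v \<in> lists A" for u v
    unfolding c_def using eq_equiv_class_iff[OF equiv_word_rel that] that by (simp add: word_rel_def)
  have \<phi>_append: "\<phi> (c (u @ v)) = \<phi> (c u) \<otimes>\<^bsub>M\<^esub> \<phi> (c v)" if "u \<in> lists A" "v \<in> lists A" for u v
    using \<phi> that cN by (simp add: c_append iso_def hom_mult)
  have \<phi>_bij: "bij_betw \<phi> (c ` lists A) (cls ` lists L)"
    using \<phi> cN carrier by (simp add: iso_def)
  have \<phi>_closed: "\<phi> (c u) \<in> cls ` lists L" if "u \<in> lists A" for u
  proof -
    have "\<phi> (c u) \<in> \<phi> ` (c ` lists A)" using that by blast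
    then show ?thesis using \<phi>_bij by (simp only: bij_betw_def)
  qed
  have \<phi>_Nil: "\<phi> (c []) = cls []"
    using idem[of "\<phi> (c [])"] \<phi>_append[of "[]" "[]"] \<phi>_closed[of "[]"] carrier by simp
  have "\<forall>a\<in>A. \<exists>w. w \<in> lists L \<and> \<phi> (c [a]) = cls w"
  proof
    fix a assume "a \<in> A"
    then have "\<phi> (c [a]) \<in> cls ` lists L" by (intro \<phi>_closed) simp
    then show "\<exists>w. w \<in> lists L \<and> \<phi> (c [a]) = cls w" by blast
  qed
  then obtain \<sigma> where \<sigma>: "\<And>a. a \<in> A \<Longrightarrow> \<sigma> a \<in> lists L \<and> \<phi> (c [a]) = cls (\<sigma> a)" by metis
  have "\<forall>x\<in>L. \<exists>w. w \<in> lists A \<and> \<phi> (c w) = cls [x]"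
  proof
    fix x assume "x \<in> L"
    then have "cls [x] \<in> \<phi> ` (c ` lists A)" using \<phi>_bij by (auto simp: bij_betw_def)
    then show "\<exists>w. w \<in> lists A \<and> \<phi> (c w) = cls [x]" by auto
  qed
  then obtain \<iota> where \<iota>: "\<And>x. x \<in> L \<Longrightarrow> \<iota> x \<in> lists A \<and> \<phi> (c (\<iota> x)) = cls [x]" by metis
  define S where "S w = concat (map \<sigma> w)" for w
  define I where "I w = concat (map \<iota> w)" for w
  have S: "S w \<in> lists L \<and> \<phi> (c w) = cls (S w)" if "w \<in> lists A" for w
    using that
  proof (induction w)
    case (Cons a w)
    then show ?case
      using \<phi>_append[of "[a]" w] \<sigma>[of a] mult[of "\<sigma> a" "S w"] by (simp add: S_def)
  qed (simp add: S_def \<phi>_Nil)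
  have I: "I w \<in> lists A \<and> \<phi> (c (I w)) = cls w" if "w \<in> lists L" for w
    using that
  proof (induction w)
    case (Cons x w)
    then show ?case
      using \<phi>_append[of "\<iota> x" "I w"] \<iota>[of x] mult[of "[x]" w] by (simp add: I_def)
  qed (simp add: I_def \<phi>_Nil)
  define T where "T = (\<lambda>(l, r). (S l, S r)) ` R \<union> (\<lambda>x. ([x], S (\<iota> x))) ` L"
  have S_cong: "word_cong T (S x) (S y)" if "word_cong R x y" for x y
    using that
  proof induction
    case (rel u v)
    then show ?case by (intro word_cong.rel) (auto simp: T_def)
  next
    case (append u v u' v')
    then show ?case by (simp add: S_def word_cong.append)
  qed (auto intro: word_cong.intros)
  have SI: "word_cong T w (S (I w))" if "w \<in> lists L" for w
    using that
  proof (induction w)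
    case (Cons x w)
    have "word_cong T [x] (S (\<iota> x))"
      using Cons.hyps by (intro word_cong.rel) (auto simp: T_def)
    from word_cong.append[OF this Cons.IH] show ?case by (simp add: S_def I_def)
  qed (simp add: S_def I_def word_cong.refl)
  have "finite T" using AR \<open>finite L\<close> by (simp add: T_def)
  moreover have "u \<in> lists L \<and> v \<in> lists L \<and> cls u = cls v" if "(u, v) \<in> T" for u v
  proof -
    from that consider (R) l r where "(l, r) \<in> R" "u = S l" "v = S r"
      | (L) x where "x \<in> L" "u = [x]" "v = S (\<iota> x)"
      by (auto simp: T_def)
    then show ?thesis
    proof cases
      case R
      then have "l \<in> lists A" "r \<in> lists A" using AR by auto
      then show ?thesis using R S c_eq word_cong.rel by metis
    next
      case L
      then show ?thesis using S \<iota> by (metis Cons_in_lists_iff lists.Nil)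
    qed
  qed
  moreover have "word_cong T u v" if uv: "u \<in> lists L" "v \<in> lists L" "cls u = cls v" for u v
  proof -
    have "c (I u) = c (I v)"
      by (rule inj_onD[OF bij_betw_imp_inj_on[OF \<phi>_bij]]) (use I uv in simp_all)
    then have "word_cong R (I u) (I v)" using c_eq I uv by blast
    then show ?thesis
      using S_cong SI uv word_cong.trans word_cong.sym by metis
  qed
  ultimately show ?thesis by (intro exI[of _ T]) auto
qed

section \<open>The submonoid\<close>

lemma (in group) left_eq_right:
  assumes [simp]: "x \<in> carrier G" "y \<in> carrier G" "s \<in> carrier G"
    and xs: "x \<otimes> s \<otimes> x = s \<otimes> x \<otimes> s" and ys: "y \<otimes> s \<otimes> y = s \<otimes> y \<otimes> s"
    and sxy: "s \<otimes> x \<otimes> y \<otimes> s \<otimes> x \<otimes> y = x \<otimes> y \<otimes> s \<otimes> x \<otimes> y \<otimes> s"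
  shows "x \<otimes> y [^] k \<otimes> (s \<otimes> x \<otimes> y \<otimes> s) = (s \<otimes> x \<otimes> y \<otimes> s) \<otimes> x [^] (k::nat) \<otimes> y"
proof -
  define p z where "p = s \<otimes> x \<otimes> y \<otimes> s" and "z = inv y \<otimes> (x \<otimes> y)"
  have [simp]: "p \<in> carrier G" "z \<in> carrier G" by (simp_all add: p_def z_def)
  have yz: "y \<otimes> z = x \<otimes> y"
    by (simp add: z_def m_assoc[symmetric])
  have "p \<otimes> y = s \<otimes> x \<otimes> (y \<otimes> s \<otimes> y)" by (simp add: p_def m_assoc)
  also have "\<dots> = (s \<otimes> x \<otimes> s) \<otimes> (y \<otimes> s)" by (simp only: ys) (simp add: m_assoc)
  also have "\<dots> = x \<otimes> p" by (simp only: xs[symmetric]) (simp add: p_def m_assoc)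
  finally have py: "p \<otimes> y = x \<otimes> p" .
  have "x \<otimes> (y \<otimes> p) = x \<otimes> (p \<otimes> z)"
  proof -
    have "x \<otimes> (y \<otimes> p) = p \<otimes> (x \<otimes> y)" using sxy by (simp add: p_def m_assoc)
    also have "\<dots> = (p \<otimes> y) \<otimes> z" by (simp add: yz m_assoc)
    also have "\<dots> = x \<otimes> (p \<otimes> z)" by (simp add: py m_assoc)
    finally show ?thesis .
  qed
  then have yp: "y \<otimes> p = p \<otimes> z" by simp
  have "y [^] k \<otimes> p = p \<otimes> z [^] k"
  proof (induction k)
    case (Suc k)
    have "y [^] Suc k \<otimes> p = (y [^] k \<otimes> p) \<otimes> z" by (simp add: m_assoc yp)
    then show ?case by (simp add: Suc m_assoc)
  qed simp
  moreover have "y \<otimes> z [^] k = x [^] k \<otimes> y"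
  proof (induction k)
    case (Suc k)
    have "y \<otimes> z [^] Suc k = x [^] k \<otimes> (y \<otimes> z)" by (simp add: Suc m_assoc[symmetric])
    then show ?case by (simp add: yz m_assoc)
  qed simp
  ultimately have "x \<otimes> y [^] k \<otimes> p = x \<otimes> p \<otimes> z [^] k" by (simp add: m_assoc)
  also have "\<dots> = p \<otimes> (y \<otimes> z [^] k)" by (simp add: py[symmetric] m_assoc)
  also have "\<dots> = p \<otimes> x [^] k \<otimes> y" by (simp add: \<open>y \<otimes> z [^] k = x [^] k \<otimes> y\<close> m_assoc)
  finally show ?thesis by (simp add: p_def)
qed

definition bmr_class :: "nat \<Rightarrow> nat \<Rightarrow> bmr_letter list \<Rightarrow> (bmr_letter \<times> bool) list set" where
  "bmr_class e r w = group_class (bmr_letters r) (bmr_group_relations e r) (pos_word w)"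

lemma pos_word_lists: "w \<in> lists A \<Longrightarrow> pos_word w \<in> lists (A \<times> UNIV)"
  by auto

lemma bmr_class_eq_iff:
  assumes "u \<in> lists (bmr_letters r)" "v \<in> lists (bmr_letters r)"
  shows "bmr_class e r u = bmr_class e r v \<longleftrightarrow>
    word_cong (bmr_group_relations e r \<union> cancellations (bmr_letters r)) (pos_word u) (pos_word v)"
  unfolding bmr_class_def group_class_def
  using eq_equiv_class_iff[OF equiv_word_rel pos_word_lists[OF assms(1)] pos_word_lists[OF assms(2)]]
    pos_word_lists[OF assms(1)] pos_word_lists[OF assms(2)]
  by (simp add: word_rel_def)

lemma bmr_class_append:
  assumes "u \<in> lists (bmr_letters r)" "v \<in> lists (bmr_letters r)"
  shows "bmr_class e r (u @ v) = bmr_class e r u \<otimes>\<^bsub>bmr_braid_group e r\<^esub> bmr_class e r v"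
  unfolding bmr_class_def group_class_def bmr_braid_group_def presented_group_def map_append
  by (rule mult_presented_monoid[symmetric]) (use assms in auto)

lemma bmr_class_Nil: "bmr_class e r [] = \<one>\<^bsub>bmr_braid_group e r\<^esub>"
  by (simp add: bmr_class_def group_class_def bmr_braid_group_def presented_group_def presented_monoid_def)

lemma bmr_class_closed: "u \<in> lists (bmr_letters r) \<Longrightarrow> bmr_class e r u \<in> carrier (bmr_braid_group e r)"
  unfolding bmr_class_def group_class_def bmr_braid_group_def presented_group_def carrier_presented_monoid
  by (rule quotientI) auto

lemma bmr_class_replicate:
  assumes "a \<in> bmr_letters r"
  shows "bmr_class e r (replicate k a) = bmr_class e r [a] [^]\<^bsub>bmr_braid_group e r\<^esub> k"
proof -
  interpret group "bmr_braid_group e r" by (rule bmr_braid_group_group)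
  show ?thesis
  proof (induction k)
    case (Suc k)
    have "replicate k a \<in> lists (bmr_letters r)" "[a] \<in> lists (bmr_letters r)"
      using assms by (simp_all add: in_listsI)
    then have "bmr_class e r (replicate k a @ [a]) =
        bmr_class e r (replicate k a) \<otimes>\<^bsub>bmr_braid_group e r\<^esub> bmr_class e r [a]"
      by (rule bmr_class_append)
    then show ?case by (simp add: Suc replicate_append_same)
  qed (simp add: bmr_class_Nil)
qed

lemma carrier_bmr_submonoid: "carrier (bmr_submonoid e r) = bmr_class e r ` lists (bmr_letters r)"
proof
  let ?B = "bmr_braid_group e r" and ?L = "bmr_letters r"
  interpret group ?B by (rule bmr_braid_group_group)
  have "submonoid (bmr_class e r ` lists ?L) ?B"
  proof
    show "\<one>\<^bsub>?B\<^esub> \<in> bmr_class e r ` lists ?L"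
      using bmr_class_Nil[of e r] by (metis imageI lists.Nil)
    fix x y assume "x \<in> bmr_class e r ` lists ?L" "y \<in> bmr_class e r ` lists ?L"
    then obtain u v where "u \<in> lists ?L" "v \<in> lists ?L" "x = bmr_class e r u" "y = bmr_class e r v"
      by blast
    then have "x \<otimes>\<^bsub>?B\<^esub> y = bmr_class e r (u @ v)" "u @ v \<in> lists ?L"
      using bmr_class_append by auto
    then show "x \<otimes>\<^bsub>?B\<^esub> y \<in> bmr_class e r ` lists ?L" by blast
  qed (use bmr_class_closed in auto)
  moreover have "bmr_generators e r \<subseteq> bmr_class e r ` lists ?L"
    unfolding bmr_generators_def bmr_class_def[symmetric] by (intro image_subsetI imageI) simp
  ultimately show "carrier (bmr_submonoid e r) \<subseteq> bmr_class e r ` lists ?L"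
    unfolding bmr_submonoid_def generated_submonoid_def by simp blast
  have sub: "submonoid (carrier (bmr_submonoid e r)) ?B" "bmr_generators e r \<subseteq> carrier (bmr_submonoid e r)"
    unfolding bmr_submonoid_def
    by (rule submonoid_generated_submonoid[OF monoid_axioms bmr_generators_carrier])+
  have "bmr_class e r w \<in> carrier (bmr_submonoid e r)" if "w \<in> lists ?L" for w
    using that
  proof (induction w)
    case Nil
    then show ?case using submonoid.one_closed[OF sub(1)] by (simp add: bmr_class_Nil)
  next
    case (Cons a w)
    have "bmr_class e r [a] \<in> carrier (bmr_submonoid e r)"
      using sub(2) Cons.hyps(1) by (auto simp: bmr_generators_def bmr_class_def)
    then show ?case
      using submonoid.m_closed[OF sub(1) _ Cons.IH] bmr_class_append[of "[a]" r w e] Cons.hyps by simp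
  qed
  then show "bmr_class e r ` lists ?L \<subseteq> carrier (bmr_submonoid e r)" by blast
qed

lemma mult_bmr_submonoid: "mult (bmr_submonoid e r) = mult (bmr_braid_group e r)"
  by (simp add: bmr_submonoid_def generated_submonoid_def)

lemma bmr_class_left_word:
  assumes "r \<ge> 3"
  shows "bmr_class e r (left_word k) = bmr_class e r (right_word k)"
proof -
  let ?B = "bmr_braid_group e r" and ?L = "bmr_letters r"
  interpret group ?B by (rule bmr_braid_group_group)
  have L [simp]: "Tau 2 \<in> ?L" "Tau2' \<in> ?L" "Tau 3 \<in> ?L"
    using assms by (auto simp: bmr_letters_def)
  let ?c = "\<lambda>a. bmr_class e r [a]"
  have Cons: "bmr_class e r (a # b # w) = ?c a \<otimes>\<^bsub>?B\<^esub> bmr_class e r (b # w)"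
    if "a \<in> ?L" "b \<in> ?L" "w \<in> lists ?L" for a b w
    using bmr_class_append[of "[a]" r "b # w" e] that by simp
  have Cons_append: "bmr_class e r (a # w @ w') = ?c a \<otimes>\<^bsub>?B\<^esub> bmr_class e r (w @ w')"
    if "a \<in> ?L" "w \<in> lists ?L" "w' \<in> lists ?L" for a w w'
    using bmr_class_append[of "[a]" r "w @ w'" e] that by simp
  have rel: "bmr_class e r u = bmr_class e r v"
    if "(u, v) \<in> bmr_relations e r" "u \<in> lists ?L" "v \<in> lists ?L" for u v
    unfolding bmr_class_eq_iff[OF that(2,3)]
    by (rule word_cong.rel) (use that(1) in \<open>auto simp: bmr_group_relations_def\<close>)
  have [simp]: "?c a \<in> carrier ?B" if "a \<in> ?L" for a
    by (rule bmr_class_closed) (use that in simp)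
  have xs: "?c (Tau 2) \<otimes>\<^bsub>?B\<^esub> ?c (Tau 3) \<otimes>\<^bsub>?B\<^esub> ?c (Tau 2) = ?c (Tau 3) \<otimes>\<^bsub>?B\<^esub> ?c (Tau 2) \<otimes>\<^bsub>?B\<^esub> ?c (Tau 3)"
    using rel[OF bmr_relations.intros(4)[of 2 r e]] assms by (simp add: Cons m_assoc)
  have ys: "?c Tau2' \<otimes>\<^bsub>?B\<^esub> ?c (Tau 3) \<otimes>\<^bsub>?B\<^esub> ?c Tau2' = ?c (Tau 3) \<otimes>\<^bsub>?B\<^esub> ?c Tau2' \<otimes>\<^bsub>?B\<^esub> ?c (Tau 3)"
    using rel[OF bmr_relations.intros(5)[OF assms]] by (simp add: Cons m_assoc)
  have sxy: "?c (Tau 3) \<otimes>\<^bsub>?B\<^esub> ?c (Tau 2) \<otimes>\<^bsub>?B\<^esub> ?c Tau2' \<otimes>\<^bsub>?B\<^esub> ?c (Tau 3) \<otimes>\<^bsub>?B\<^esub> ?c (Tau 2) \<otimes>\<^bsub>?B\<^esub> ?c Tau2' =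
      ?c (Tau 2) \<otimes>\<^bsub>?B\<^esub> ?c Tau2' \<otimes>\<^bsub>?B\<^esub> ?c (Tau 3) \<otimes>\<^bsub>?B\<^esub> ?c (Tau 2) \<otimes>\<^bsub>?B\<^esub> ?c Tau2' \<otimes>\<^bsub>?B\<^esub> ?c (Tau 3)"
    using rel[OF bmr_relations.intros(6)[OF assms]] by (simp add: Cons m_assoc)
  have rep: "replicate k a \<in> lists ?L" if "a \<in> ?L" for a using that by (simp add: in_listsI)
  have "bmr_class e r (left_word k) = ?c (Tau 2) \<otimes>\<^bsub>?B\<^esub> ?c Tau2' [^]\<^bsub>?B\<^esub> k \<otimes>\<^bsub>?B\<^esub>
      (?c (Tau 3) \<otimes>\<^bsub>?B\<^esub> ?c (Tau 2) \<otimes>\<^bsub>?B\<^esub> ?c Tau2' \<otimes>\<^bsub>?B\<^esub> ?c (Tau 3))"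
    unfolding left_word_def
    by (simp add: Cons Cons_append bmr_class_append bmr_class_replicate rep m_assoc del: in_lists_conv_set)
  also have "\<dots> = (?c (Tau 3) \<otimes>\<^bsub>?B\<^esub> ?c (Tau 2) \<otimes>\<^bsub>?B\<^esub> ?c Tau2' \<otimes>\<^bsub>?B\<^esub> ?c (Tau 3)) \<otimes>\<^bsub>?B\<^esub>
      ?c (Tau 2) [^]\<^bsub>?B\<^esub> k \<otimes>\<^bsub>?B\<^esub> ?c Tau2'"
    by (rule left_eq_right[OF _ _ _ xs ys sxy]) simp_all
  also have "\<dots> = bmr_class e r (right_word k)"
    unfolding right_word_def
    by (simp add: Cons Cons_append bmr_class_append bmr_class_replicate rep m_assoc del: in_lists_conv_set)
  finally show ?thesis .
qed

theorem proposition9p1: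
  fixes e n r :: nat
  assumes "e \<ge> 3" and "n \<ge> 2" and "r = n + 1"
  shows "\<not> finitely_presented_monoid (bmr_submonoid e r)"
proof
  let ?B = "bmr_braid_group e r" and ?L = "bmr_letters r"
  interpret group ?B by (rule bmr_braid_group_group)
  assume fp: "finitely_presented_monoid (bmr_submonoid e r)"
  have fin: "finite ?L" by (simp add: bmr_letters_def)
  have mult: "bmr_class e r (u @ v) = bmr_class e r u \<otimes>\<^bsub>bmr_submonoid e r\<^esub> bmr_class e r v"
    if "u \<in> lists ?L" "v \<in> lists ?L" for u v
    unfolding mult_bmr_submonoid using that by (rule bmr_class_append)
  have idem: "x = bmr_class e r []"
    if "x \<in> carrier (bmr_submonoid e r)" "x \<otimes>\<^bsub>bmr_submonoid e r\<^esub> x = x" for x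
  proof -
    have "x \<in> carrier ?B" using that(1) bmr_class_closed by (auto simp: carrier_bmr_submonoid)
    then show ?thesis using that(2) by (simp add: mult_bmr_submonoid bmr_class_Nil)
  qed
  have "\<exists>T. finite T \<and> T \<subseteq> {(u, v) \<in> lists ?L \<times> lists ?L. bmr_class e r u = bmr_class e r v} \<and>
      (\<forall>(u, v) \<in> lists ?L \<times> lists ?L. bmr_class e r u = bmr_class e r v \<longrightarrow> word_cong T u v)"
    by (rule finitely_presented_monoid_over_generators[OF fp fin carrier_bmr_submonoid, OF mult idem])
  then obtain T where fin_T: "finite T"
    and T_sound: "T \<subseteq> {(u, v) \<in> lists ?L \<times> lists ?L. bmr_class e r u = bmr_class e r v}"
    and T_complete: "\<forall>(u, v) \<in> lists ?L \<times> lists ?L. bmr_class e r u = bmr_class e r v \<longrightarrow> word_cong T u v"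
    by (elim exE conjE)
  have T: "u \<in> lists ?L \<and> v \<in> lists ?L \<and> bmr_class e r u = bmr_class e r v" if "(u, v) \<in> T" for u v
    using subsetD[OF T_sound that] by simp
  define k where "k = 2 + (\<Sum>(u, v)\<in>T. length u + length v)"
  have "k \<ge> 2" by (simp add: k_def)
  have short: "length u < k" "length v < k" if "(u, v) \<in> T" for u v
  proof -
    have "(\<lambda>(u, v). length u + length v) (u, v) \<le> (\<Sum>(u, v)\<in>T. length u + length v)"
      by (rule member_le_sum[OF that _ fin_T]) simp
    then show "length u < k" "length v < k" by (simp_all add: k_def)
  qed
  have "r \<ge> 3" using assms by simp
  then have lists: "left_word k \<in> lists ?L" "right_word k \<in> lists ?L"
    by (auto simp: left_word_def right_word_def bmr_letters_def)
  have site: "\<forall>l\<in>set w. site l \<ge> 2" if "w \<in> lists ?L" for w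
    using that by (auto simp: bmr_letters_def)
  have *: "p @ v @ q = left_word k"
    if u: "p @ u @ q = left_word k" and cls: "bmr_class e r u = bmr_class e r v"
      and L: "u \<in> lists ?L" "v \<in> lists ?L" and "length u < k" for p q u v
  proof -
    have "p @ u @ q \<in> lists ?L" unfolding u by (rule lists(1))
    then have pq: "p \<in> lists ?L" "q \<in> lists ?L" by simp_all
    have pvq: "p @ v @ q \<in> lists ?L" using pq L by simp
    have "bmr_class e r (p @ v @ q) = bmr_class e r (p @ u @ q)"
      using cls L pq by (simp add: bmr_class_append)
    then have "word_cong (bmr_group_relations e r \<union> cancellations ?L)
        (pos_word (p @ v @ q)) (pos_word (left_word k))"
      unfolding u bmr_class_eq_iff[OF pvq lists(1)] .
    then have "p @ v @ q = left_word k \<or> p @ v @ q = right_word k"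
      by (rule eq_left_word_or_right_word[OF assms(1) \<open>k \<ge> 2\<close> site[OF pvq]])
    moreover have "p @ v @ q \<noteq> right_word k"
    proof
      assume v: "p @ v @ q = right_word k"
      have "p = []"
      proof (rule ccontr)
        assume "p \<noteq> []"
        then have "hd (p @ u @ q) = hd (p @ v @ q)" by simp
        then show False unfolding u v by (simp add: left_word_def right_word_def)
      qed
      moreover have "q = []"
      proof (rule ccontr)
        assume "q \<noteq> []"
        then have "last (p @ u @ q) = last (p @ v @ q)" by simp
        then show False unfolding u v by (simp add: left_word_def right_word_def)
      qed
      ultimately have "length u = length (left_word k)" using u by simp
      then show False using \<open>length u < k\<close> by (simp add: left_word_def)
    qed
    ultimately show ?thesis by blast
  qed
  have "word_cong T (left_word k) (right_word k)"
    using bspec[OF T_complete, of "(left_word k, right_word k)"] lists bmr_class_left_word[OF \<open>r \<ge> 3\<close>] by simp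
  then have "[] @ left_word k @ [] = left_word k \<longleftrightarrow> [] @ right_word k @ [] = left_word k"
  proof (rule word_cong_context[where P = "\<lambda>w. w = left_word k"])
    fix u v p q assume uv: "(u, v) \<in> T"
    show "p @ u @ q = left_word k \<longleftrightarrow> p @ v @ q = left_word k"
    proof
      assume "p @ u @ q = left_word k"
      then show "p @ v @ q = left_word k" by (rule *) (use T[OF uv] short[OF uv] in simp_all)
    next
      assume "p @ v @ q = left_word k"
      then show "p @ u @ q = left_word k" by (rule *) (use T[OF uv] short[OF uv] in simp_all)
    qed
  qed
  then show False by (simp add: left_word_def right_word_def)
qed

end
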